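(* Let $E(q)=\prod_{k\ge1}(1-q^k)$, $$X=\frac{E(q^2)^4E(q^3)^8}{E(q)^8E(q^6)^4},\qquad \xi=q^{-2}\frac{E(q^2)^5E(q^9)^4}{E(q)^4E(q^{18})^5},$$ and let $U$ be the operator on formal Laurent series defined by $U\left(\sum_{n\ge n_0}a_nq^n\right)=\sum_{3n\ge n_0}a_{3n}q^n$. Then \begin{align*} U(\xi)&=9X,\\ U(\xi X)&=-9X+252X^2-891X^3+729X^4,\\ U(\xi X^2)&=X-378X^2+8613X^3-54675X^4+138510X^5-150903X^6+59049X^7,\\ U(\xi X^3)&=147X^2-14553X^3+312255X^4-2617839X^5+10764414X^6\\ &\qquad-23914845X^7+29288304X^8-18600435X^9+4782969X^{10}. \end{align*}
   Context: All identities are identities of formal Laurent series in $q$. *)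

theory Defs
  imports "HOL-Computational_Algebra.Formal_Laurent_Series"
begin

text \<open>Euler product E(q) = prod_{k>=1} (1 - q^k), as the limit (in the usual
  q-adic topology of formal power series) of its finite partial products.\<close>
definition euler_E :: "rat fps" where
  "euler_E = lim (\<lambda>N. \<Prod>k\<in>{1..N}. (1 - fps_X ^ k))"

definition Eq :: "nat \<Rightarrow> rat fls" where
  "Eq m = fls_compose_power (fps_to_fls euler_E) m"

definition Xs :: "rat fls" where
  "Xs = (Eq 2 ^ 4 * Eq 3 ^ 8) / (Eq 1 ^ 8 * Eq 6 ^ 4)"

definition xi :: "rat fls" where
  "xi = fls_X_intpow (-2) * ((Eq 2 ^ 5 * Eq 9 ^ 4) / (Eq 1 ^ 4 * Eq 18 ^ 5))"

lift_definition U3 :: "'a::zero fls \<Rightarrow> 'a fls" is "\<lambda>f n. f (3 * n)"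
proof -
  fix f :: "int \<Rightarrow> 'a"
  assume *: "eventually (\<lambda>n. f (-int n) = 0) cofinite"
  hence "eventually (\<lambda>n. f (-int n) = 0) at_top"
    by (simp add: cofinite_eq_sequentially)
  hence "eventually (\<lambda>n. f (-int (3 * n)) = 0) at_top"
    by (rule eventually_compose_filterlim) (simp add: filterlim_subseq strict_mono_def)
  thus "eventually (\<lambda>n. f (3 * (-int n)) = 0) cofinite"
    by (simp add: cofinite_eq_sequentially)
qed

end

theory Submission
  imports Defs "HOL-Analysis.Infinite_Sum"
begin

text \<open>
  Write \<open>\<phi>(q) = E(q)\<^sup>2/E(q\<^sup>2)\<close> and \<open>\<psi>(q) = E(q\<^sup>2)\<^sup>2/E(q)\<close>, so that \<open>X = \<phi>(q\<^sup>3)\<^sup>4/\<phi>(q)\<^sup>4\<close> and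
  \<open>\<xi> = q\<^sup>-\<^sup>2 \<psi>(q)\<^sup>2 \<phi>(q\<^sup>9) / (\<phi>(q) \<psi>(q\<^sup>9)\<^sup>2)\<close>. By the Jacobi triple product both are theta series, and
  splitting the summation index modulo 3 gives \<open>\<phi>(q) = \<phi>(q\<^sup>9) (1 - 2\<tau>)\<close> and
  \<open>\<psi>(q) = q \<psi>(q\<^sup>9) (1 + 1/\<tau>)\<close> with one and the same series \<open>\<tau>\<close>, whose exponents are all 1 modulo 3.
  Multiplying the conjugates of \<open>\<phi>\<close> under \<open>q \<mapsto> \<omega>q\<close>, where \<open>\<omega>\<^sup>3 = 1\<close>, gives
  \<open>\<phi>(q\<^sup>3)\<^sup>4 = \<phi>(q\<^sup>9)\<^sup>4 (1 - 8\<tau>\<^sup>3)\<close>.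

  With \<open>A = \<phi>(q\<^sup>9)/\<phi>(q) = 1/(1 - 2\<tau>)\<close> this last identity becomes the cubic equation
  \<open>A\<^sup>3 = X(q\<^sup>3) (3A\<^sup>2 - 3A + 1)\<close>. Since \<open>U (f(q\<^sup>3) g) = f U g\<close>, every sequence \<open>U (f A\<^sup>n)\<close> satisfies the recurrence
  \<open>c\<^sub>n\<^sub>+\<^sub>3 = X (3c\<^sub>n\<^sub>+\<^sub>2 - 3c\<^sub>n\<^sub>+\<^sub>1 + c\<^sub>n)\<close>. For \<open>f = (1 + 1/\<tau>)\<^sup>2 (1 - 2\<tau>)\<^sup>2\<close> the initial values are \<open>-3, -3, 1\<close>,
  and \<open>c\<^sub>4\<^sub>k\<^sub>+\<^sub>3 = X\<^sup>k U (\<xi> X\<^sup>k)\<close> because \<open>\<xi> = f A\<^sup>3\<close> and \<open>A\<^sup>4 = X X(q\<^sup>3)\<close>.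
\<close>

subsection \<open>Limits of formal power series\<close>

instance fps :: (ab_group_add) topological_comm_monoid_add
proof
  fix f g :: "'a fps"
  let ?F = "nhds f \<times>\<^sub>F nhds g"
  show "filterlim (\<lambda>x. fst x + snd x) (nhds (f + g)) ?F"
  proof (rule tendsto_fpsI)
    fix n :: nat
    have "\<forall>\<^sub>F x in ?F. fst x $ n = f $ n" "\<forall>\<^sub>F x in ?F. snd x $ n = g $ n"
      using filterlim_fst[of "nhds f" "nhds g"] filterlim_snd[of "nhds g" "nhds f"]
      by (simp_all add: tendsto_fps_iff)
    thus "\<forall>\<^sub>F x in ?F. (fst x + snd x) $ n = (f + g) $ n"
      by eventually_elim simp
  qed
qed

instance fps :: (comm_ring_1) topological_comm_monoid_mult
proof
  fix f g :: "'a fps"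
  let ?F = "nhds f \<times>\<^sub>F nhds g"
  show "filterlim (\<lambda>x. fst x * snd x) (nhds (f * g)) ?F"
  proof (rule tendsto_fpsI)
    fix n :: nat
    have "\<forall>\<^sub>F x in ?F. \<forall>i\<in>{..n}. fst x $ i = f $ i" "\<forall>\<^sub>F x in ?F. \<forall>i\<in>{..n}. snd x $ i = g $ i"
      using filterlim_fst[of "nhds f" "nhds g"] filterlim_snd[of "nhds g" "nhds f"]
      by (simp_all add: tendsto_fps_iff eventually_ball_finite_distrib)
    thus "\<forall>\<^sub>F x in ?F. (fst x * snd x) $ n = (f * g) $ n"
      by eventually_elim (simp add: fps_mult_nth)
  qed
qed

lemma tendsto_fps_compose:
  "(f \<longlongrightarrow> a) F \<Longrightarrow> ((\<lambda>x. f x oo g) \<longlongrightarrow> (a oo g)) F" for a g :: "'a :: ring_1 fps"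
proof (rule tendsto_fpsI)
  fix n assume "(f \<longlongrightarrow> a) F"
  hence "\<forall>\<^sub>F x in F. \<forall>i\<in>{0..n}. f x $ i = a $ i"
    by (simp add: tendsto_fps_iff eventually_ball_finite_distrib)
  thus "\<forall>\<^sub>F x in F. (f x oo g) $ n = (a oo g) $ n"
    by eventually_elim (simp add: fps_compose_nth)
qed

lemma tendsto_fps_weighted_sum:
  fixes f :: "'a \<Rightarrow> 'b :: comm_ring_1 fps"
  assumes sum: "(f has_sum s) UNIV"
    and weights: "\<And>k. (\<lambda>n. c n k) \<longlonglongrightarrow> l"
    and windows: "filterlim A (finite_subsets_at_top UNIV) sequentially"
  shows "(\<lambda>n. \<Sum>k\<in>A n. c n k * f k) \<longlonglongrightarrow> l * s"
proof -
  have "((\<lambda>k. l * f k) has_sum l * s) UNIV"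
    by (intro has_sum_cmult_right sum)
  hence "(\<lambda>n. \<Sum>k\<in>A n. l * f k) \<longlonglongrightarrow> l * s"
    unfolding has_sum_def using windows by (rule filterlim_compose)
  moreover have "(\<lambda>n. \<Sum>k\<in>A n. (c n k - l) * f k) \<longlonglongrightarrow> 0"
  proof (rule tendsto_fpsI)
    fix j :: nat
    define B where "B = (\<Union>i\<le>j. {k. f k $ i \<noteq> 0})"
    have "finite B"
      using has_sum_fpsD(1)[OF sum] by (simp add: B_def)
    hence "\<forall>\<^sub>F n in sequentially. \<forall>k\<in>B. \<forall>i\<in>{..j}. c n k $ i = l $ i"
      using weights by (simp add: tendsto_fps_iff eventually_ball_finite_distrib)
    thus "\<forall>\<^sub>F n in sequentially. (\<Sum>k\<in>A n. (c n k - l) * f k) $ j = 0 $ j"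
    proof eventually_elim
      case (elim n)
      have "((c n k - l) * f k) $ j = 0" for k
        using elim by (cases "k \<in> B") (auto simp: fps_mult_nth B_def intro!: sum.neutral)
      thus ?case
        by (simp add: fps_sum_nth)
    qed
  qed
  ultimately have "(\<lambda>n. (\<Sum>k\<in>A n. l * f k) + (\<Sum>k\<in>A n. (c n k - l) * f k)) \<longlonglongrightarrow> l * s + 0"
    by (rule tendsto_add)
  thus ?thesis
    by (simp add: left_diff_distrib flip: sum.distrib)
qed

subsection \<open>Shifted factorials\<close>

definition qpochhammer :: "nat \<Rightarrow> 'a \<Rightarrow> 'a \<Rightarrow> 'a :: comm_ring_1" where
  "qpochhammer n a q = (\<Prod>k<n. 1 - a * q ^ k)"

definition qpochhammer_inf :: "'a fps \<Rightarrow> 'a fps \<Rightarrow> 'a :: comm_ring_1 fps" where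
  "qpochhammer_inf a q = lim (\<lambda>n. qpochhammer n a q)"

lemma qpochhammer_0 [simp]: "qpochhammer 0 a q = 1"
  and qpochhammer_Suc: "qpochhammer (Suc n) a q = qpochhammer n a q * (1 - a * q ^ n)"
  by (simp_all add: qpochhammer_def)

lemma qpochhammer_Suc_shift: "qpochhammer (Suc n) a q = (1 - a) * qpochhammer n (a * q) q"
  by (simp add: qpochhammer_def prod.lessThan_Suc_shift mult_ac del: prod.lessThan_Suc)

lemma qpochhammer_tendsto:
  fixes a q :: "'a :: comm_ring_1 fps"
  assumes "q $ 0 = 0"
  shows "(\<lambda>n. qpochhammer n a q) \<longlonglongrightarrow> qpochhammer_inf a q"
proof -
  have stable: "qpochhammer n a q $ i = qpochhammer (Suc i) a q $ i" if "Suc i \<le> n" for n i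
    using that
  proof (induction n rule: dec_induct)
    case (step n)
    have "(qpochhammer n a q * a * q ^ n) $ i = 0"
      unfolding fps_mult_nth[of _ "q ^ n"] using step.hyps assms
      by (intro sum.neutral) (auto simp: startsby_zero_power_prefix)
    with step.IH show ?case
      by (simp add: qpochhammer_Suc right_diff_distrib mult.assoc)
  qed simp
  have "(\<lambda>n. qpochhammer n a q) \<longlonglongrightarrow> Abs_fps (\<lambda>i. qpochhammer (Suc i) a q $ i)"
  proof (rule tendsto_fpsI)
    fix i
    show "\<forall>\<^sub>F n in sequentially. qpochhammer n a q $ i = Abs_fps (\<lambda>i. qpochhammer (Suc i) a q $ i) $ i"
      using eventually_ge_at_top[of "Suc i"] by eventually_elim (metis stable fps_nth_Abs_fps)
  qed
  thus ?thesis
    unfolding qpochhammer_inf_def by (simp add: limI)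
qed

lemma qpochhammer_tendsto_subseq:
  fixes a q :: "'a :: comm_ring_1 fps"
  assumes "q $ 0 = 0" and "filterlim g sequentially sequentially"
  shows "(\<lambda>n. qpochhammer (g n) a q) \<longlonglongrightarrow> qpochhammer_inf a q"
  using qpochhammer_tendsto[OF assms(1)] assms(2) by (rule filterlim_compose)

lemma qpochhammer_inf_eqI:
  fixes a q b :: "'a :: comm_ring_1 fps"
  assumes "q $ 0 = 0" and "\<And>n. qpochhammer n a q = f n" and "f \<longlonglongrightarrow> b"
  shows "qpochhammer_inf a q = b"
  using LIMSEQ_unique qpochhammer_tendsto[OF assms(1), of a] assms(2,3) by simp

lemma qpochhammer_inf_rec:
  fixes a q :: "'a :: comm_ring_1 fps"
  assumes "q $ 0 = 0"
  shows "qpochhammer_inf a q = (1 - a) * qpochhammer_inf (a * q) q"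
proof (rule LIMSEQ_unique)
  show "(\<lambda>n. qpochhammer (Suc n) a q) \<longlonglongrightarrow> qpochhammer_inf a q"
    using assms by (intro qpochhammer_tendsto_subseq filterlim_Suc)
  show "(\<lambda>n. qpochhammer (Suc n) a q) \<longlonglongrightarrow> (1 - a) * qpochhammer_inf (a * q) q"
    unfolding qpochhammer_Suc_shift using assms by (intro tendsto_intros qpochhammer_tendsto)
qed

lemma qpochhammer_inf_mult_uminus:
  fixes a q :: "'a :: comm_ring_1 fps"
  assumes "q $ 0 = 0"
  shows "qpochhammer_inf a q * qpochhammer_inf (- a) q = qpochhammer_inf (a ^ 2) (q ^ 2)"
proof (rule qpochhammer_inf_eqI[symmetric])
  show "qpochhammer n (a ^ 2) (q ^ 2) = qpochhammer n a q * qpochhammer n (- a) q" for n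
    unfolding qpochhammer_def prod.distrib[symmetric]
    by (intro prod.cong) (simp_all add: algebra_simps power2_eq_square)
  show "(\<lambda>n. qpochhammer n a q * qpochhammer n (- a) q) \<longlonglongrightarrow> qpochhammer_inf a q * qpochhammer_inf (- a) q"
    using assms by (intro tendsto_intros qpochhammer_tendsto)
qed (use assms in \<open>simp add: startsby_zero_power\<close>)

lemma qpochhammer_mult:
  "qpochhammer (m * n) a q = (\<Prod>j<m. qpochhammer n (a * q ^ j) (q ^ m))"
proof (induction n)
  case (Suc n)
  have "qpochhammer (k + m) a q = qpochhammer k a q * (\<Prod>j<m. 1 - a * q ^ (k + j))" for k
    by (induction m) (simp_all add: qpochhammer_Suc mult.assoc)
  from this[of "m * n"] Suc show ?case
    by (simp add: qpochhammer_Suc prod.distrib power_add power_mult mult_ac add.commute)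
qed simp

lemma qpochhammer_inf_dissect:
  fixes a q :: "'a :: comm_ring_1 fps"
  assumes "q $ 0 = 0" and "m > 0"
  shows "qpochhammer_inf a q = (\<Prod>j<m. qpochhammer_inf (a * q ^ j) (q ^ m))"
proof (rule LIMSEQ_unique)
  have "filterlim ((*) m) sequentially sequentially"
    using assms(2) by (intro filterlim_subseq) (simp add: strict_mono_def)
  thus "(\<lambda>n. qpochhammer (m * n) a q) \<longlonglongrightarrow> qpochhammer_inf a q"
    using assms(1) by (intro qpochhammer_tendsto_subseq)
  show "(\<lambda>n. qpochhammer (m * n) a q) \<longlonglongrightarrow> (\<Prod>j<m. qpochhammer_inf (a * q ^ j) (q ^ m))"
    unfolding qpochhammer_mult using assms by (intro tendsto_intros qpochhammer_tendsto)
      (simp add: startsby_zero_power)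
qed

lemma qpochhammer_nth_0: "a $ 0 = 0 \<Longrightarrow> qpochhammer n a q $ 0 = 1" for a q :: "'a :: comm_ring_1 fps"
  by (induction n) (simp_all add: qpochhammer_Suc)

lemma qpochhammer_inf_nth_0:
  fixes a q :: "'a :: comm_ring_1 fps"
  assumes "q $ 0 = 0" and "a $ 0 = 0"
  shows "qpochhammer_inf a q $ 0 = 1"
proof -
  have "\<forall>\<^sub>F n in sequentially. qpochhammer n a q $ 0 = qpochhammer_inf a q $ 0"
    using qpochhammer_tendsto[OF assms(1)] by (simp add: tendsto_fps_iff)
  thus ?thesis
    using assms(2) by (simp add: qpochhammer_nth_0)
qed

lemma fps_compose_qpochhammer_inf:
  fixes a q g :: "'a :: idom fps"
  assumes q: "q $ 0 = 0" and g: "g $ 0 = 0"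
  shows "qpochhammer_inf a q oo g = qpochhammer_inf (a oo g) (q oo g)"
proof (rule qpochhammer_inf_eqI[symmetric])
  show "qpochhammer n (a oo g) (q oo g) = qpochhammer n a q oo g" for n
    by (induction n)
      (simp_all add: qpochhammer_Suc fps_compose_mult_distrib[OF g] fps_compose_sub_distrib fps_compose_power[OF g])
  show "(\<lambda>n. qpochhammer n a q oo g) \<longlonglongrightarrow> (qpochhammer_inf a q oo g)"
    using q by (intro tendsto_fps_compose qpochhammer_tendsto)
qed (use q in simp)

subsection \<open>The Jacobi triple product\<close>

definition qbinomial :: "'a :: field fps \<Rightarrow> nat \<Rightarrow> nat \<Rightarrow> 'a fps" where
  "qbinomial q n k =
     (if k \<le> n then qpochhammer n q q * inverse (qpochhammer k q q * qpochhammer (n - k) q q) else 0)"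

lemma qpochhammer_self_nonzero: "q $ 0 = 0 \<Longrightarrow> qpochhammer n q q \<noteq> 0" for q :: "'a :: field fps"
  by (metis fps_zero_nth qpochhammer_nth_0 zero_neq_one)

lemma qbinomial_mult_qpochhammer:
  assumes "q $ 0 = 0" and "k \<le> n"
  shows "qbinomial q n k * (qpochhammer k q q * qpochhammer (n - k) q q) = qpochhammer n q q"
  using assms by (simp add: qbinomial_def mult.assoc inverse_mult_eq_1 qpochhammer_nth_0)

lemma qbinomial_0: "q $ 0 = 0 \<Longrightarrow> qbinomial q n 0 = 1"
  by (simp add: qbinomial_def inverse_mult_eq_1' qpochhammer_nth_0)

lemma qbinomial_symmetric: "k \<le> n \<Longrightarrow> qbinomial q n (n - k) = qbinomial q n k"
  by (simp add: qbinomial_def mult.commute)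

lemma qbinomial_self: "q $ 0 = 0 \<Longrightarrow> qbinomial q n n = 1"
  using qbinomial_symmetric[of 0 n q] by (simp add: qbinomial_0)

lemma qbinomial_Suc_Suc:
  assumes q: "q $ 0 = 0" and "k \<le> n"
  shows "qbinomial q (Suc n) (Suc k) = q ^ (n - k) * qbinomial q n k + qbinomial q n (Suc k)"
proof (cases "k = n")
  case True
  thus ?thesis
    using q by (simp add: qbinomial_self qbinomial_def[of q n "Suc n"])
next
  case False
  with \<open>k \<le> n\<close> obtain d where n: "n = Suc (k + d)"
    by (metis le_neq_implies_less less_iff_Suc_add)
  let ?D = "qpochhammer (Suc k) q q * qpochhammer (Suc d) q q"
  have numerators: "qbinomial q (Suc n) (Suc k) * ?D = qpochhammer n q q * (1 - q ^ (Suc k + Suc d))"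
      "qbinomial q n k * ?D = qpochhammer n q q * (1 - q ^ Suc k)"
      "qbinomial q n (Suc k) * ?D = qpochhammer n q q * (1 - q ^ Suc d)"
    using qbinomial_mult_qpochhammer[OF q, of "Suc k" "Suc n"]
      qbinomial_mult_qpochhammer[OF q, of k n] qbinomial_mult_qpochhammer[OF q, of "Suc k" n]
    by (simp_all add: n qpochhammer_Suc mult_ac del: power_Suc) (simp_all add: power_add mult_ac)
  have "(q ^ (n - k) * qbinomial q n k + qbinomial q n (Suc k)) * ?D =
        q ^ Suc d * (qbinomial q n k * ?D) + qbinomial q n (Suc k) * ?D"
    by (simp add: n distrib_right mult.assoc)
  also have "\<dots> = qbinomial q (Suc n) (Suc k) * ?D"
    unfolding numerators by (simp add: algebra_simps power_add)
  finally show ?thesis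
    using q by (simp add: qpochhammer_self_nonzero)
qed

definition triangular :: "int \<Rightarrow> nat" where
  "triangular k = nat (k * (k + 1) div 2)"

lemma double_triangular: "2 * int (triangular k) = k * (k + 1)"
proof -
  have "k * (k + 1) \<ge> 0"
    by (cases "k \<ge> 0") (simp_all add: mult_nonpos_nonpos)
  thus ?thesis by (simp add: triangular_def)
qed

lemma triangular_eqI: "2 * int n = k * (k + 1) \<Longrightarrow> triangular k = n"
  using double_triangular[of k] by linarith

lemma triangular_uminus: "triangular (- k) = triangular (k - 1)"
  by (intro triangular_eqI) (simp add: double_triangular algebra_simps)

definition theta_term :: "'a :: comm_ring_1 \<Rightarrow> 'a \<Rightarrow> int \<Rightarrow> 'a" where
  "theta_term x y k = x ^ triangular k * y ^ triangular (k - 1)"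

lemma theta_term_commute: "theta_term y x k = theta_term x y (- k)"
  using triangular_uminus[of "k + 1"] by (simp add: theta_term_def triangular_uminus mult.commute)

lemma theta_term_Suc:
  assumes "k \<le> int m"
  shows "x * (x * y) ^ m * theta_term x y k = (x * y) ^ nat (int m - k) * theta_term x y (k + 1)"
proof -
  have "Suc (m + triangular k) = nat (int m - k) + triangular (k + 1)"
       "m + triangular (k - 1) = nat (int m - k) + triangular k"
    using assms double_triangular[of k] double_triangular[of "k + 1"] double_triangular[of "k - 1"]
    by (simp_all add: algebra_simps flip: of_nat_eq_iff[where ?'a = int])
  hence "x ^ Suc (m + triangular k) * y ^ (m + triangular (k - 1)) =
         x ^ (nat (int m - k) + triangular (k + 1)) * y ^ (nat (int m - k) + triangular k)"
    by (simp only:)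
  thus ?thesis
    by (simp add: theta_term_def power_add power_mult_distrib mult_ac)
qed

text \<open>With Gaussian binomial weights the truncated theta series factors at every finite stage.\<close>
definition finite_theta :: "'a :: field fps \<Rightarrow> 'a fps \<Rightarrow> nat \<Rightarrow> nat \<Rightarrow> 'a fps" where
  "finite_theta x y m n = (\<Sum>j\<le>m + n. qbinomial (x * y) (m + n) j * theta_term x y (int j - int n))"

lemma finite_theta_commute: "finite_theta x y m n = finite_theta y x n m"
  unfolding finite_theta_def
  by (rule sum.reindex_bij_witness[of _ "\<lambda>j. m + n - j" "\<lambda>j. m + n - j"])
    (auto simp: theta_term_commute[of y x] qbinomial_symmetric add.commute mult.commute)

lemma finite_theta_Suc:
  assumes xy: "(x * y) $ 0 = 0"
  shows "finite_theta x y (Suc m) n = (1 + x * (x * y) ^ m) * finite_theta x y m n"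
proof -
  let ?q = "x * y" and ?s = "\<lambda>j. theta_term x y (int j - int n)"
  let ?b = "qbinomial ?q (m + n)"
  have "(1 + x * ?q ^ m) * finite_theta x y m n = (\<Sum>j\<le>m + n. ?b j * ((1 + x * ?q ^ m) * ?s j))"
    by (simp add: finite_theta_def sum_distrib_left mult_ac)
  also have "\<dots> = (\<Sum>j\<le>m + n. ?b j * (?s j + ?q ^ (m + n - j) * ?s (Suc j)))"
  proof (intro sum.cong refl arg_cong2[of _ _ _ _ "(*)"])
    fix j assume "j \<in> {..m + n}"
    moreover from this have "nat (int m - (int j - int n)) = m + n - j"
      by auto
    ultimately show "(1 + x * ?q ^ m) * ?s j = ?s j + ?q ^ (m + n - j) * ?s (Suc j)"
      using theta_term_Suc[of "int j - int n" m x y] by (simp add: algebra_simps)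
  qed
  also have "\<dots> = (\<Sum>j\<le>Suc (m + n). ?b j * ?s j) + (\<Sum>j\<le>m + n. ?q ^ (m + n - j) * ?b j * ?s (Suc j))"
    by (simp add: sum.distrib distrib_left mult_ac qbinomial_def[of _ _ "Suc (m + n)"])
  also have "\<dots> = ?b 0 * ?s 0 + (\<Sum>j\<le>m + n. (?q ^ (m + n - j) * ?b j + ?b (Suc j)) * ?s (Suc j))"
    by (subst sum.atMost_Suc_shift) (simp add: sum.distrib algebra_simps)
  also have "\<dots> = (\<Sum>j\<le>Suc (m + n). qbinomial ?q (Suc (m + n)) j * ?s j)"
    by (subst sum.atMost_Suc_shift) (simp add: qbinomial_Suc_Suc[OF xy] qbinomial_0[OF xy])
  finally show ?thesis
    by (simp add: finite_theta_def)
qed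

lemma finite_jacobi_triple_product:
  assumes xy: "(x * y) $ 0 = 0"
  shows "finite_theta x y m n = qpochhammer m (- x) (x * y) * qpochhammer n (- y) (x * y)"
proof (induction m)
  case 0
  have "finite_theta y x n 0 = qpochhammer n (- y) (y * x)"
  proof (induction n)
    case 0
    show ?case
      by (simp add: finite_theta_def theta_term_def triangular_def qbinomial_def)
  next
    case (Suc n)
    thus ?case
      using xy by (simp add: finite_theta_Suc qpochhammer_Suc mult_ac)
  qed
  thus ?case
    by (simp add: finite_theta_commute[of x] mult.commute)
next
  case (Suc m)
  thus ?case
    by (simp add: finite_theta_Suc[OF xy] qpochhammer_Suc mult_ac)
qed

definition ramanujan_theta :: "'a fps \<Rightarrow> 'a fps \<Rightarrow> 'a :: comm_ring_1 fps" where
  "ramanujan_theta x y = (\<Sum>\<^sub>\<infinity>k. theta_term x y k)"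

lemma theta_term_nth_eq_0:
  fixes x y :: "'a :: comm_ring_1 fps"
  assumes xy: "(x * y) $ 0 = 0" and k: "\<bar>k\<bar> > int n + 1"
  shows "theta_term x y k $ n = 0"
proof -
  have "0 \<le> (\<bar>k\<bar> - 1) * (\<bar>k\<bar> - 2)"
    using k by simp
  hence "2 * (int n + 1) \<le> k * (k + 1)" "2 * (int n + 1) \<le> (k - 1) * k"
    using k by (cases "k \<ge> 0"; simp add: algebra_simps)+
  hence "Suc n \<le> triangular k" "Suc n \<le> triangular (k - 1)"
    using double_triangular[of k] double_triangular[of "k - 1"] by simp_all
  then obtain i j where "triangular k = Suc n + i" "triangular (k - 1) = Suc n + j"
    by (auto simp: le_iff_add)
  hence "theta_term x y k = x ^ i * y ^ j * (x * y) ^ Suc n"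
    by (simp add: theta_term_def power_add power_mult_distrib mult_ac)
  also have "\<dots> $ n = 0"
    unfolding fps_mult_nth[of _ "_ ^ Suc n"] using xy
    by (intro sum.neutral) (auto simp: startsby_zero_power_prefix simp del: power_Suc)
  finally show ?thesis .
qed

lemma has_sum_ramanujan_theta:
  fixes x y :: "'a :: comm_ring_1 fps"
  assumes "(x * y) $ 0 = 0"
  shows "(theta_term x y has_sum ramanujan_theta x y) UNIV"
proof -
  have "{k. theta_term x y k $ n \<noteq> 0} \<subseteq> {- int n - 1..int n + 1}" for n
    using theta_term_nth_eq_0[OF assms, of n] by force
  hence finite: "finite {k. theta_term x y k $ n \<noteq> 0}" for n
    by (rule finite_subset) simp
  define s where "s = Abs_fps (\<lambda>n. \<Sum>k | theta_term x y k $ n \<noteq> 0. theta_term x y k $ n)"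
  have "(theta_term x y has_sum s) UNIV"
    by (intro has_sum_fpsI) (simp_all add: finite s_def)
  thus ?thesis
    unfolding ramanujan_theta_def by (intro has_sum_infsum has_sum_imp_summable)
qed

lemma ramanujan_theta_commute: "ramanujan_theta x y = ramanujan_theta y x"
  unfolding ramanujan_theta_def theta_term_commute[of x y]
  by (intro infsum_reindex_bij_witness[of _ uminus uminus]) auto

lemma qbinomial_central_tendsto:
  assumes q: "q $ 0 = 0"
  shows "(\<lambda>n. qbinomial q (n + n) (nat (k + int n))) \<longlonglongrightarrow> inverse (qpochhammer_inf q q)"
proof (rule Lim_transform_eventually)
  let ?L = "qpochhammer_inf q q"
  let ?P = "\<lambda>l n. qpochhammer (nat (l + int n)) q q"
  have "filterlim (\<lambda>n. nat (l + int n)) sequentially sequentially" for l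
    unfolding filterlim_at_top
  proof
    fix m
    show "\<forall>\<^sub>F n in sequentially. m \<le> nat (l + int n)"
      using eventually_ge_at_top[of "m + nat \<bar>l\<bar>"] by eventually_elim linarith
  qed
  hence lim: "?P l \<longlonglongrightarrow> ?L" for l
    using q by (intro qpochhammer_tendsto_subseq)
  have lim_double: "(\<lambda>n. qpochhammer (n + n) q q) \<longlonglongrightarrow> ?L"
    using q by (intro qpochhammer_tendsto_subseq filterlim_at_top_mono[OF filterlim_ident]) auto
  have "(\<lambda>n. qpochhammer (n + n) q q * inverse (?P k n * ?P (- k) n)) \<longlonglongrightarrow> ?L * inverse (?L * ?L)"
    using q by (intro tendsto_intros lim lim_double) (simp add: qpochhammer_inf_nth_0)
  also have "?L * inverse (?L * ?L) = inverse ?L"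
    using q by (simp add: fps_inverse_mult qpochhammer_inf_nth_0 inverse_mult_eq_1' flip: mult.assoc)
  finally show "(\<lambda>n. qpochhammer (n + n) q q * inverse (?P k n * ?P (- k) n)) \<longlonglongrightarrow> inverse ?L" .
  show "\<forall>\<^sub>F n in sequentially. qpochhammer (n + n) q q * inverse (?P k n * ?P (- k) n) =
      qbinomial q (n + n) (nat (k + int n))"
    using eventually_ge_at_top[of "nat \<bar>k\<bar>"]
  proof eventually_elim
    case (elim n)
    hence "nat (k + int n) \<le> n + n" "n + n - nat (k + int n) = nat (- k + int n)"
      by linarith+
    thus ?case by (simp add: qbinomial_def)
  qed
qed

lemma filterlim_int_interval_finite_subsets:
  "filterlim (\<lambda>n. {- int n..int n}) (finite_subsets_at_top UNIV) sequentially"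
  unfolding filterlim_finite_subsets_at_top
  proof (intro allI impI)
  fix A :: "int set"
  assume "finite A \<and> A \<subseteq> UNIV"
  moreover have "\<forall>\<^sub>F n in sequentially. k \<in> {- int n..int n}" for k
    using eventually_ge_at_top[of "nat \<bar>k\<bar>"] by eventually_elim auto
  ultimately have "\<forall>\<^sub>F n in sequentially. \<forall>k\<in>A. k \<in> {- int n..int n}"
    by (simp add: eventually_ball_finite_distrib)
  thus "\<forall>\<^sub>F n in sequentially. finite {- int n..int n} \<and> A \<subseteq> {- int n..int n} \<and> {- int n..int n} \<subseteq> UNIV"
    by eventually_elim auto
qed

theorem jacobi_triple_product:
  fixes x y :: "'a :: field fps"
  assumes xy: "(x * y) $ 0 = 0"
  defines "q \<equiv> x * y"
  shows "ramanujan_theta x y = qpochhammer_inf q q * qpochhammer_inf (- x) q * qpochhammer_inf (- y) q"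
proof -
  have "finite_theta x y n n =
      (\<Sum>k\<in>{- int n..int n}. qbinomial q (n + n) (nat (k + int n)) * theta_term x y k)" for n
    unfolding finite_theta_def q_def
    by (rule sum.reindex_bij_witness[of _ "\<lambda>k. nat (k + int n)" "\<lambda>j. int j - int n"]) auto
  hence "(\<lambda>n. finite_theta x y n n) \<longlonglongrightarrow> inverse (qpochhammer_inf q q) * ramanujan_theta x y"
    using tendsto_fps_weighted_sum[OF has_sum_ramanujan_theta[OF xy] qbinomial_central_tendsto[OF xy]
        filterlim_int_interval_finite_subsets]
    by (simp add: q_def)
  moreover have "(\<lambda>n. finite_theta x y n n) \<longlonglongrightarrow> qpochhammer_inf (- x) q * qpochhammer_inf (- y) q"
    unfolding finite_jacobi_triple_product[OF xy] q_def
    using xy by (intro tendsto_intros qpochhammer_tendsto)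
  ultimately have "inverse (qpochhammer_inf q q) * ramanujan_theta x y =
      qpochhammer_inf (- x) q * qpochhammer_inf (- y) q"
    by (rule LIMSEQ_unique)
  moreover have "qpochhammer_inf q q * inverse (qpochhammer_inf q q) = 1"
    using xy by (simp add: q_def inverse_mult_eq_1' qpochhammer_inf_nth_0)
  ultimately show ?thesis
    by (metis mult.assoc mult_1)
qed

subsection \<open>Trisection of theta series and eta quotients\<close>

lemma has_sum_int_trisection:
  fixes f :: "int \<Rightarrow> 'a :: topological_comm_monoid_add"
  assumes "((\<lambda>m. f (3 * m)) has_sum a) UNIV" "((\<lambda>m. f (3 * m + 1)) has_sum b) UNIV"
    "((\<lambda>m. f (3 * m - 1)) has_sum c) UNIV"
  shows "(f has_sum a + b + c) UNIV"
proof -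
  let ?R = "\<lambda>r. range (\<lambda>m. 3 * m + r :: int)"
  have "(f has_sum a) (?R 0)" "(f has_sum b) (?R 1)" "(f has_sum c) (?R (- 1))"
    using assms by (simp_all add: has_sum_reindex inj_on_def comp_def)
  moreover have "?R 0 \<inter> ?R 1 = {}" "(?R 0 \<union> ?R 1) \<inter> ?R (- 1) = {}"
    by (auto, presburger+)
  moreover have "?R 0 \<union> ?R 1 \<union> ?R (- 1) = UNIV"
  proof -
    have "\<exists>m. k = 3 * m \<or> k = 3 * m + 1 \<or> k = 3 * m - 1" for k :: int
      by presburger
    thus ?thesis by fastforce
  qed
  ultimately show ?thesis
    by (metis has_sum_Un_disjoint)
qed

lemma triangular_trisection:
  "triangular (3 * m) = 6 * triangular m + 3 * triangular (m - 1)"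
  "triangular (3 * m + 1) = Suc (9 * triangular m)"
  "triangular (3 * m - 1) = 3 * triangular m + 6 * triangular (m - 1)"
  using double_triangular[of m] double_triangular[of "m - 1"]
  by (intro triangular_eqI, simp add: algebra_simps)+

lemma theta_term_trisection:
  "theta_term x y (3 * m) = theta_term (x ^ 6 * y ^ 3) (x ^ 3 * y ^ 6) m"
  "theta_term x y (3 * m + 1) = x * theta_term (x ^ 9 * y ^ 6) (y ^ 3) m"
  "theta_term x y (3 * m - 1) = y * theta_term (x ^ 3) (x ^ 6 * y ^ 9) m"
  using triangular_trisection[of m] triangular_trisection(2)[of "m - 1"]
  by (simp_all add: theta_term_def power_mult_distrib power_add mult_ac flip: power_mult)

lemma ramanujan_theta_trisection:
  fixes x y :: "'a :: comm_ring_1 fps"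
  assumes "(x * y) $ 0 = 0"
  shows "ramanujan_theta x y = ramanujan_theta (x ^ 6 * y ^ 3) (x ^ 3 * y ^ 6)
    + x * ramanujan_theta (x ^ 9 * y ^ 6) (y ^ 3) + y * ramanujan_theta (x ^ 3) (x ^ 6 * y ^ 9)"
proof (rule has_sum_unique)
  show "(theta_term x y has_sum ramanujan_theta x y) UNIV"
    using assms by (rule has_sum_ramanujan_theta)
  have "x ^ 6 * y ^ 3 * (x ^ 3 * y ^ 6) = (x * y) ^ 9" "x ^ 9 * y ^ 6 * y ^ 3 = (x * y) ^ 9"
    "x ^ 3 * (x ^ 6 * y ^ 9) = (x * y) ^ 9"
    by (simp_all add: power_mult_distrib mult_ac flip: power_add)
  hence "(x ^ 6 * y ^ 3 * (x ^ 3 * y ^ 6)) $ 0 = 0" "(x ^ 9 * y ^ 6 * y ^ 3) $ 0 = 0"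
    "(x ^ 3 * (x ^ 6 * y ^ 9)) $ 0 = 0"
    using assms startsby_zero_power[of "x * y" 9] by (simp_all only:)
  thus "(theta_term x y has_sum ramanujan_theta (x ^ 6 * y ^ 3) (x ^ 3 * y ^ 6)
    + x * ramanujan_theta (x ^ 9 * y ^ 6) (y ^ 3) + y * ramanujan_theta (x ^ 3) (x ^ 6 * y ^ 9)) UNIV"
    by (intro has_sum_int_trisection; unfold theta_term_trisection)
      (intro has_sum_cmult_right has_sum_ramanujan_theta; assumption)+
qed

lemma ramanujan_theta_phi_trisection:
  fixes q :: "'a :: comm_ring_1 fps"
  assumes "q $ 0 = 0"
  shows "ramanujan_theta (- q) (- q) =
    ramanujan_theta (- (q ^ 9)) (- (q ^ 9)) - 2 * q * ramanujan_theta (- (q ^ 3)) (- (q ^ 15))"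
  using assms ramanujan_theta_trisection[of "- q" "- q"] ramanujan_theta_commute[of "- (q ^ 15)"]
  by (simp add: mult_ac flip: power_add)

lemma ramanujan_theta_psi_trisection:
  fixes q :: "'a :: comm_ring_1 fps"
  assumes "q $ 0 = 0"
  shows "ramanujan_theta 1 q = 2 * ramanujan_theta (q ^ 3) (q ^ 6) + q * ramanujan_theta 1 (q ^ 9)"
  using assms ramanujan_theta_trisection[of 1 q] ramanujan_theta_commute[of "q ^ 6"] by simp

definition euler_function :: "'a fps \<Rightarrow> 'a :: comm_ring_1 fps" where
  "euler_function q = qpochhammer_inf q q"

lemma euler_function_nth_0: "q $ 0 = 0 \<Longrightarrow> euler_function q $ 0 = 1"
  by (simp add: euler_function_def qpochhammer_inf_nth_0)

lemma euler_function_nonzero: "q $ 0 = 0 \<Longrightarrow> euler_function q \<noteq> 0"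
  by (metis euler_function_nth_0 fps_zero_nth zero_neq_one)

lemma fps_compose_euler_function:
  fixes q g :: "'a :: idom fps"
  assumes "q $ 0 = 0" "g $ 0 = 0"
  shows "euler_function q oo g = euler_function (q oo g)"
  using assms by (simp add: euler_function_def fps_compose_qpochhammer_inf)

lemma euler_function_dissect:
  fixes q :: "'a :: comm_ring_1 fps"
  assumes "q $ 0 = 0" "m > 0"
  shows "euler_function q = (\<Prod>j<m. qpochhammer_inf (q ^ Suc j) (q ^ m))"
  using assms qpochhammer_inf_dissect[of q m q] by (simp add: euler_function_def)

lemma euler_function_mult_uminus:
  fixes q :: "'a :: comm_ring_1 fps"
  assumes "q $ 0 = 0"
  shows "euler_function q * qpochhammer_inf (- q) q = euler_function (q ^ 2)"
  using assms by (simp add: euler_function_def qpochhammer_inf_mult_uminus)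

lemma fps_compose_ramanujan_theta:
  fixes x y g :: "'a :: field fps"
  assumes "(x * y) $ 0 = 0" "g $ 0 = 0"
  shows "ramanujan_theta x y oo g = ramanujan_theta (x oo g) (y oo g)"
proof -
  define q where "q = x * y"
  have q: "(x oo g) * (y oo g) = q oo g" and q_nth_0: "q $ 0 = 0"
    using assms by (simp_all add: q_def fps_compose_mult_distrib)
  hence "((x oo g) * (y oo g)) $ 0 = 0"
    by (simp only: fps_compose_nth_0)
  note triple_products =
    jacobi_triple_product[OF assms(1), folded q_def] jacobi_triple_product[OF this, unfolded q]
  show ?thesis
    unfolding triple_products using assms(2) q_nth_0
    by (simp add: fps_compose_mult_distrib fps_compose_qpochhammer_inf fps_compose_uminus)
qed

context
  fixes q :: "'a :: field fps"
  assumes q: "q $ 0 = 0"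
begin

lemma ramanujan_theta_phi_euler:
  "ramanujan_theta (- q) (- q) * euler_function (q ^ 2) = euler_function q ^ 2"
proof -
  have "ramanujan_theta (- q) (- q) = euler_function (q ^ 2) * qpochhammer_inf q (q ^ 2) ^ 2"
    using q jacobi_triple_product[of "- q" "- q"]
    by (simp add: euler_function_def power2_eq_square mult.assoc)
  moreover have "euler_function q = qpochhammer_inf q (q ^ 2) * euler_function (q ^ 2)"
    using euler_function_dissect[OF q, of 2] by (simp add: numeral_2_eq_2 euler_function_def)
  ultimately show ?thesis
    by (simp add: power_mult_distrib) (simp add: power2_eq_square mult_ac)
qed

text \<open>\<open>f(1, q) = 2\<psi>(q)\<close> is preferred to the more usual \<open>f(q, q\<^sup>3) = \<psi>(q)\<close> because its trisection needs no regrouping.\<close>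
lemma ramanujan_theta_psi_euler:
  "ramanujan_theta 1 q * euler_function q = 2 * euler_function (q ^ 2) ^ 2"
proof -
  have "ramanujan_theta 1 q = 2 * euler_function q * qpochhammer_inf (- q) q ^ 2"
    using q jacobi_triple_product[of 1 q] qpochhammer_inf_rec[of q "- 1"]
    by (simp add: euler_function_def power2_eq_square mult_ac)
  thus ?thesis
    unfolding euler_function_mult_uminus[OF q, symmetric]
    by (simp add: power_mult_distrib power2_eq_square mult_ac)
qed

lemma ramanujan_theta_1_2_euler:
  "ramanujan_theta q (q ^ 2) * (euler_function q * euler_function (q ^ 6)) =
     euler_function (q ^ 2) * euler_function (q ^ 3) ^ 2"
proof -
  let ?m = "\<lambda>j. qpochhammer_inf (- (q ^ j)) (q ^ 3)"
  have "ramanujan_theta q (q ^ 2) = euler_function (q ^ 3) * ?m 1 * ?m 2"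
    using q jacobi_triple_product[of q "q ^ 2"] by (simp add: euler_function_def eval_nat_numeral)
  moreover have "euler_function q * (?m 1 * ?m 2 * ?m 3) = euler_function (q ^ 2)"
    using qpochhammer_inf_dissect[of q 3 "- q"] euler_function_mult_uminus[OF q] q
    by (simp add: eval_nat_numeral)
  moreover have "euler_function (q ^ 3) * ?m 3 = euler_function (q ^ 6)"
    using q euler_function_mult_uminus[of "q ^ 3"] by (simp flip: power_mult)
  ultimately show ?thesis
    by algebra
qed

lemma ramanujan_theta_1_5_euler:
  "ramanujan_theta (- q) (- (q ^ 5)) * (euler_function (q ^ 2) * euler_function (q ^ 3)) =
     euler_function q * euler_function (q ^ 6) ^ 2"
proof -
  let ?p = "\<lambda>j. qpochhammer_inf (q ^ j) (q ^ 6)"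
  have "ramanujan_theta (- q) (- (q ^ 5)) = ?p 6 * ?p 1 * ?p 5"
    using q jacobi_triple_product[of "- q" "- (q ^ 5)"] by (simp add: eval_nat_numeral)
  moreover have "euler_function q = ?p 1 * ?p 2 * ?p 3 * ?p 4 * ?p 5 * ?p 6"
    using euler_function_dissect[OF q, of 6] by (simp add: eval_nat_numeral)
  moreover have "euler_function (q ^ 2) = ?p 2 * ?p 4 * ?p 6"
    using q euler_function_dissect[of "q ^ 2" 3] by (simp add: eval_nat_numeral mult_ac)
  moreover have "euler_function (q ^ 3) = ?p 3 * ?p 6"
    using q euler_function_dissect[of "q ^ 3" 2] by (simp add: eval_nat_numeral mult_ac)
  ultimately show ?thesis
    by (simp add: euler_function_def power2_eq_square mult_ac)
qed

end

subsection \<open>The norm over third roots of unity\<close>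

definition fps_section :: "nat \<Rightarrow> nat \<Rightarrow> 'a :: zero fps \<Rightarrow> 'a fps" where
  "fps_section m r f = Abs_fps (\<lambda>n. if n mod m = r then f $ n else 0)"

lemma fps_section_nth [simp]: "fps_section m r f $ n = (if n mod m = r then f $ n else 0)"
  by (simp add: fps_section_def)

lemma fps_section_add: "fps_section m r (f + g) = fps_section m r f + fps_section m r g"
  for f g :: "'a :: monoid_add fps"
  by (simp add: fps_eq_iff)

lemma fps_section_diff: "fps_section m r (f - g) = fps_section m r f - fps_section m r g"
  for f g :: "'a :: group_add fps"
  by (simp add: fps_eq_iff)

lemma fps_section_sum: "fps_section m r (\<Sum>i\<in>A. f i) = (\<Sum>i\<in>A. fps_section m r (f i))"
  for f :: "'b \<Rightarrow> 'a :: comm_monoid_add fps"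
  by (simp add: fps_eq_iff fps_sum_nth)

lemma sum_fps_section: "m > 0 \<Longrightarrow> (\<Sum>r<m. fps_section m r f) = f"
  for f :: "'a :: comm_monoid_add fps"
  by (simp add: fps_eq_iff fps_sum_nth)

lemma fps_section_mult_sections:
  fixes f g :: "'a :: comm_ring_1 fps"
  shows "fps_section m r (fps_section m s f * fps_section m t g) =
     (if (s + t) mod m = r then fps_section m s f * fps_section m t g else 0)"
proof (rule fps_ext)
  fix n
  have "(fps_section m s f * fps_section m t g) $ n = 0" if "n mod m \<noteq> (s + t) mod m"
  proof -
    have "i mod m \<noteq> s \<or> (n - i) mod m \<noteq> t" if "i \<le> n" for i
      using \<open>n mod m \<noteq> (s + t) mod m\<close> mod_add_eq[of i m "n - i"] that by auto
    thus ?thesis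
      by (auto simp: fps_mult_nth intro!: sum.neutral)
  qed
  thus "fps_section m r (fps_section m s f * fps_section m t g) $ n =
      (if (s + t) mod m = r then fps_section m s f * fps_section m t g else 0) $ n"
    by auto
qed

lemma fps_section_mult:
  fixes f g :: "'a :: comm_ring_1 fps"
  assumes "m > 0"
  shows "fps_section m r (f * g) =
     (\<Sum>s<m. \<Sum>t<m. if (s + t) mod m = r then fps_section m s f * fps_section m t g else 0)"
proof -
  have "f * g = (\<Sum>s<m. \<Sum>t<m. fps_section m s f * fps_section m t g)"
    by (simp add: sum_fps_section[OF assms] flip: sum_product)
  thus ?thesis
    by (simp only: fps_section_sum fps_section_mult_sections)
qed

lemma fps_section_X_power:
  "fps_section m r (fps_X ^ k :: 'a :: comm_ring_1 fps) = (if k mod m = r then fps_X ^ k else 0)"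
  by (simp add: fps_eq_iff)

lemma fps_section_X_power_compose:
  fixes f :: "'a :: comm_ring_1 fps"
  assumes "k < m"
  shows "fps_section m r (fps_X ^ k * (f oo fps_X ^ m)) =
    (if k = r then fps_X ^ k * (f oo fps_X ^ m) else 0)"
proof -
  have "n mod m = k" if "k \<le> n" "m dvd n - k" for n
    using assms that
    by (metis dvd_imp_mod_0 le_add_diff_inverse mod_add_right_eq mod_less add.right_neutral)
  thus ?thesis
    by (auto simp: fps_eq_iff fps_X_power_mult_nth fps_nth_compose_X_power)
qed

text \<open>This is \<open>f(q) f(\<omega>q) f(\<omega>\<^sup>2q)\<close> for a primitive third root of unity \<open>\<omega>\<close>; expressing it
  through the sections of \<open>f\<close> keeps the coefficients rational.\<close>
definition trinorm :: "'a :: comm_ring_1 fps \<Rightarrow> 'a fps" where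
  "trinorm f = fps_section 3 0 f ^ 3 + fps_section 3 1 f ^ 3 + fps_section 3 2 f ^ 3
     - 3 * (fps_section 3 0 f * fps_section 3 1 f * fps_section 3 2 f)"

lemma circulant_norm_mult:
  fixes a b c a' b' c' :: "'a :: comm_ring_1"
  shows "(a * a' + b * c' + c * b') ^ 3 + (a * b' + b * a' + c * c') ^ 3 + (a * c' + b * b' + c * a') ^ 3
      - 3 * ((a * a' + b * c' + c * b') * (a * b' + b * a' + c * c') * (a * c' + b * b' + c * a')) =
    (a ^ 3 + b ^ 3 + c ^ 3 - 3 * (a * b * c)) * (a' ^ 3 + b' ^ 3 + c' ^ 3 - 3 * (a' * b' * c'))"
  by (simp add: algebra_simps power3_eq_cube)

lemma trinorm_mult: "trinorm (f * g) = trinorm f * trinorm g" for f g :: "'a :: comm_ring_1 fps"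
proof -
  have lessThan_3: "{..<3} = {0, 1, 2 :: nat}"
    by auto
  have sections: "fps_section 3 0 (f * g) = fps_section 3 0 f * fps_section 3 0 g
          + fps_section 3 1 f * fps_section 3 2 g + fps_section 3 2 f * fps_section 3 1 g"
       "fps_section 3 1 (f * g) = fps_section 3 0 f * fps_section 3 1 g
          + fps_section 3 1 f * fps_section 3 0 g + fps_section 3 2 f * fps_section 3 2 g"
       "fps_section 3 2 (f * g) = fps_section 3 0 f * fps_section 3 2 g
          + fps_section 3 1 f * fps_section 3 1 g + fps_section 3 2 f * fps_section 3 0 g"
    by (simp_all add: fps_section_mult lessThan_3)
  show ?thesis
    unfolding trinorm_def sections by (rule circulant_norm_mult)
qed

lemma trinorm_1 [simp]: "trinorm 1 = (1 :: 'a :: comm_ring_1 fps)"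
  using fps_section_X_power[of 3 _ 0, where ?'a = 'a] by (simp add: trinorm_def)

lemma trinorm_power: "trinorm (f ^ n) = trinorm f ^ n"
  by (induction n) (simp_all add: trinorm_mult)

lemma tendsto_trinorm:
  fixes f :: "'b \<Rightarrow> 'a :: comm_ring_1 fps"
  assumes "(f \<longlongrightarrow> a) F"
  shows "((\<lambda>x. trinorm (f x)) \<longlongrightarrow> trinorm a) F"
proof -
  have "((\<lambda>x. fps_section 3 r (f x)) \<longlongrightarrow> fps_section 3 r a) F" for r
    using assms by (auto simp: tendsto_fps_iff)
  thus ?thesis
    unfolding trinorm_def diff_conv_add_uminus mult_minus_left[symmetric]
    by (intro tendsto_intros)
qed

lemma trinorm_one_minus_X_power:
  "trinorm (1 - fps_X ^ k :: 'a :: comm_ring_1 fps) =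
     (if 3 dvd k then (1 - fps_X ^ k) ^ 3 else 1 - fps_X ^ (3 * k))"
proof -
  have section_1: "fps_section 3 r (1 :: 'a fps) = (if r = 0 then 1 else 0)" for r
    using fps_section_X_power[of 3 r 0, where ?'a = 'a] by simp
  consider "k mod 3 = 0" | "k mod 3 = 1" | "k mod 3 = 2"
    by linarith
  thus ?thesis
    by cases (simp_all add: trinorm_def fps_section_diff fps_section_X_power section_1 dvd_eq_mod_eq_0
      mult.commute[of 3] power_mult)
qed

lemma trinorm_add_X_mult:
  fixes f g :: "'a :: comm_ring_1 fps"
  shows "trinorm ((f oo fps_X ^ 3) + fps_X * (g oo fps_X ^ 3)) =
    (f oo fps_X ^ 3) ^ 3 + (fps_X * (g oo fps_X ^ 3)) ^ 3"
  using fps_section_X_power_compose[of 0 3 _ f] fps_section_X_power_compose[of 1 3 _ g]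
  by (simp add: trinorm_def fps_section_add)

lemma trinorm_qpochhammer_inf_not_dvd:
  fixes a b :: nat
  assumes "\<not> 3 dvd a" "b > 0"
  shows "trinorm (qpochhammer_inf (fps_X ^ a) (fps_X ^ (3 * b))) =
    (qpochhammer_inf (fps_X ^ (3 * a)) (fps_X ^ (9 * b)) :: 'a :: comm_ring_1 fps)"
proof (rule qpochhammer_inf_eqI[symmetric])
  show "qpochhammer n (fps_X ^ (3 * a)) (fps_X ^ (9 * b)) =
      trinorm (qpochhammer n (fps_X ^ a) (fps_X ^ (3 * b)) :: 'a fps)" for n
  proof (induction n)
    case (Suc n)
    have "\<not> 3 dvd a + 3 * b * n"
      using assms(1) by (simp add: mult.assoc dvd_add_left_iff)
    hence "trinorm (1 - fps_X ^ a * (fps_X ^ (3 * b)) ^ n) =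
        (1 - fps_X ^ (3 * a) * (fps_X ^ (9 * b)) ^ n :: 'a fps)"
      using trinorm_one_minus_X_power[of "a + 3 * b * n", where ?'a = 'a]
      by (simp add: distrib_left mult.assoc flip: power_mult power_add)
    with Suc show ?case
      by (simp only: qpochhammer_Suc trinorm_mult)
  qed simp
  show "(\<lambda>n. trinorm (qpochhammer n (fps_X ^ a) (fps_X ^ (3 * b)) :: 'a fps)) \<longlonglongrightarrow>
      trinorm (qpochhammer_inf (fps_X ^ a) (fps_X ^ (3 * b)))"
    using assms by (intro tendsto_trinorm qpochhammer_tendsto) simp
qed (use assms in simp)

lemma trinorm_euler_function:
  fixes m :: nat
  assumes "\<not> 3 dvd m"
  shows "trinorm (euler_function (fps_X ^ m)) * euler_function (fps_X ^ (9 * m)) =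
    (euler_function (fps_X ^ (3 * m)) :: 'a :: idom fps) ^ 4"
proof -
  let ?p = "\<lambda>j k. qpochhammer_inf (fps_X ^ (j * m)) (fps_X ^ (k * m)) :: 'a fps"
  have m: "m > 0" "\<not> 3 dvd 2 * m"
    using assms by presburger+
  have "euler_function (fps_X ^ m) = ?p 1 3 * ?p 2 3 * ?p 3 3"
    using m euler_function_dissect[of "fps_X ^ m :: 'a fps" 3]
    by (simp add: lessThan_nat_numeral lessThan_Suc mult_ac flip: power_mult power_Suc mult_2_right)
  moreover have "trinorm (?p 3 3) = ?p 3 3 ^ 3"
    using m trinorm_add_X_mult[of "euler_function (fps_X ^ m) :: 'a fps" 0]
      fps_compose_euler_function[of "fps_X ^ m :: 'a fps" "fps_X ^ 3"]
    by (simp add: euler_function_def mult.commute flip: fps_compose_power power_mult)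
  ultimately have "trinorm (euler_function (fps_X ^ m)) = ?p 3 9 * ?p 6 9 * ?p 3 3 ^ 3"
    using assms m trinorm_qpochhammer_inf_not_dvd[of m m, where ?'a = 'a]
      trinorm_qpochhammer_inf_not_dvd[of "2 * m" m, where ?'a = 'a]
    by (simp add: trinorm_mult euler_function_def)
  moreover have "euler_function (fps_X ^ (3 * m)) = ?p 3 9 * ?p 6 9 * ?p 9 9"
    using m euler_function_dissect[of "fps_X ^ (3 * m) :: 'a fps" 3]
    by (simp add: lessThan_nat_numeral lessThan_Suc mult_ac flip: power_mult power_Suc mult_2_right)
  ultimately show ?thesis
    by (simp add: euler_function_def eval_nat_numeral mult_ac)
qed

subsection \<open>The trisection operator\<close>

abbreviation (input) V3 :: "'a :: zero fls \<Rightarrow> 'a fls" where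
  "V3 f \<equiv> fls_compose_power f 3"

lemma fls_compose_power_inverse:
  fixes f :: "'a :: field fls"
  assumes "d > 0"
  shows "fls_compose_power (inverse f) d = inverse (fls_compose_power f d)"
proof (cases "f = 0")
  case False
  hence "fls_compose_power f d * fls_compose_power (inverse f) d = 1"
    using assms by (simp flip: fls_compose_power_mult)
  thus ?thesis
    by (rule inverse_unique[symmetric])
qed simp

lemma fls_compose_power_divide:
  "d > 0 \<Longrightarrow> fls_compose_power (f / g :: 'a :: field fls) d = fls_compose_power f d / fls_compose_power g d"
  by (simp add: divide_inverse fls_compose_power_inverse)

lemma fls_compose_power_power_int:
  "d > 0 \<Longrightarrow> fls_compose_power (f powi k) d = fls_compose_power f d powi k" for f :: "'a :: field fls"
  by (simp add: power_int_def fls_compose_power_inverse)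

lemma fls_compose_power_compose_power:
  assumes "c > 0" "d > 0"
  shows "fls_compose_power (fls_compose_power f c) d = fls_compose_power f (d * c)"
  using assms
  by (intro fls_eqI)
    (auto simp: fls_nth_compose_power dvd_div_iff_mult zdiv_zmult2_eq mult.commute dest: dvd_mult_left)

lemma U3_add: "U3 (f + g) = U3 f + U3 g" for f g :: "'a :: monoid_add fls"
  by (intro fls_eqI) (simp add: U3.rep_eq)

lemma U3_diff: "U3 (f - g) = U3 f - U3 g" for f g :: "'a :: group_add fls"
  by (intro fls_eqI) (simp add: U3.rep_eq)

lemma U3_V3: "U3 (V3 f) = f"
  by (intro fls_eqI) (simp add: U3.rep_eq fls_nth_compose_power)

lemma U3_X_intpow_mult_V3:
  fixes f :: "'a :: comm_ring_1 fls"
  assumes "\<not> 3 dvd r"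
  shows "U3 (fls_X_intpow r * V3 f) = 0"
proof (rule fls_eqI)
  fix n
  have "\<not> 3 dvd 3 * n - r"
    using assms by presburger
  thus "fls_nth (U3 (fls_X_intpow r * V3 f)) n = fls_nth 0 n"
    by (simp add: U3.rep_eq fls_nth_compose_power fls_X_intpow_times_conv_shift)
qed

lemma fls_trisection:
  fixes f :: "'a :: comm_ring_1 fls"
  obtains a b c where "f = V3 a + fls_X_intpow 1 * V3 b + fls_X_intpow 2 * V3 c"
proof
  show "f = V3 (U3 f) + fls_X_intpow 1 * V3 (U3 (fls_shift 1 f)) + fls_X_intpow 2 * V3 (U3 (fls_shift 2 f))"
  proof (rule fls_eqI)
    fix n :: int
    have "\<exists>m. n = 3 * m \<or> n = 3 * m + 1 \<or> n = 3 * m + 2"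
      by presburger
    then obtain m where "n = 3 * m \<or> n = 3 * m + 1 \<or> n = 3 * m + 2" ..
    moreover have "\<not> 3 dvd 3 * m - 1" "\<not> 3 dvd 3 * m - 2" "\<not> 3 dvd 3 * m + 1" "\<not> 3 dvd 1 + 3 * m"
      "\<not> 3 dvd 3 * m + 2"
      by presburger+
    ultimately show "fls_nth f n = fls_nth (V3 (U3 f) + fls_X_intpow 1 * V3 (U3 (fls_shift 1 f))
        + fls_X_intpow 2 * V3 (U3 (fls_shift 2 f))) n"
      by (auto simp: U3.rep_eq fls_nth_compose_power fls_X_intpow_times_conv_shift)
  qed
qed

lemma U3_V3_mult: "U3 (V3 f * g) = f * U3 g" for f g :: "'a :: idom fls"
proof -
  obtain a b c where g: "g = V3 a + fls_X_intpow 1 * V3 b + fls_X_intpow 2 * V3 c"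
    by (rule fls_trisection)
  have "U3 (V3 h + fls_X_intpow 1 * V3 h' + fls_X_intpow 2 * V3 h'') = h" for h h' h'' :: "'a fls"
    by (simp add: U3_add U3_V3 U3_X_intpow_mult_V3)
  from this[of a b c] this[of "f * a" "f * b" "f * c"] show ?thesis
    unfolding g by (simp add: distrib_left mult_ac)
qed

lemma V3_numeral: "V3 (numeral n :: 'a :: comm_ring_1 fls) = numeral n"
  by (metis fls_const_numeral fls_compose_power_const_left zero_less_numeral)

lemma U3_numeral_mult: "U3 (numeral n * f) = numeral n * U3 f" for f :: "'a :: idom fls"
  using U3_V3_mult[of "numeral n" f] by (simp add: V3_numeral)

subsection \<open>Theta quotients\<close>

lemma Eq_conv_euler_function:
  assumes "m > 0"
  shows "Eq m = fps_to_fls (euler_function (fps_X ^ m))"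
proof -
  have euler_E: "euler_E = euler_function fps_X"
    unfolding euler_E_def euler_function_def qpochhammer_inf_def qpochhammer_def
    by (simp add: prod.atLeast1_atMost_eq)
  show ?thesis
    unfolding Eq_def euler_E using assms
    by (simp add: fls_compose_power_fps_to_fls fps_compose_euler_function)
qed

lemma Eq_nonzero [simp]: "m > 0 \<Longrightarrow> Eq m \<noteq> 0"
  by (simp add: Eq_conv_euler_function euler_function_nonzero)

lemma Eq_compose_power: "m > 0 \<Longrightarrow> d > 0 \<Longrightarrow> fls_compose_power (Eq m) d = Eq (d * m)"
  by (simp add: Eq_def fls_compose_power_compose_power)

definition phi :: "nat \<Rightarrow> rat fls" where
  "phi m = Eq m ^ 2 / Eq (2 * m)"

definition psi :: "nat \<Rightarrow> rat fls" where
  "psi m = Eq (2 * m) ^ 2 / Eq m"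

definition tau :: "rat fls" where
  "tau = fls_X * (Eq 3 * Eq 18 ^ 3 / (Eq 6 * Eq 9 ^ 3))"

lemma phi_nonzero [simp]: "m > 0 \<Longrightarrow> phi m \<noteq> 0"
  and psi_nonzero [simp]: "m > 0 \<Longrightarrow> psi m \<noteq> 0"
  and tau_nonzero [simp]: "tau \<noteq> 0"
  by (simp_all add: phi_def psi_def tau_def)

lemma phi_compose_power: "m > 0 \<Longrightarrow> d > 0 \<Longrightarrow> fls_compose_power (phi m) d = phi (d * m)"
  by (simp add: phi_def fls_compose_power_divide Eq_compose_power mult.left_commute)

lemmas euler_function_to_fls = nonzero_eq_divide_eq Eq_conv_euler_function euler_function_nonzero
  fls_times_fps_to_fls fps_to_fls_power

lemma fps_to_fls_theta_phi:
  "m > 0 \<Longrightarrow> fps_to_fls (ramanujan_theta (- (fps_X ^ m)) (- (fps_X ^ m))) = phi m"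
  using arg_cong[OF ramanujan_theta_phi_euler[of "fps_X ^ m"], of fps_to_fls]
  by (simp add: phi_def euler_function_to_fls mult.commute[of _ m] flip: power_mult)

lemma fps_to_fls_theta_psi:
  "m > 0 \<Longrightarrow> fps_to_fls (ramanujan_theta 1 (fps_X ^ m)) = 2 * psi m"
  using arg_cong[OF ramanujan_theta_psi_euler[of "fps_X ^ m"], of fps_to_fls]
  by (simp add: psi_def euler_function_to_fls mult.commute[of _ m] flip: power_mult)

lemma fps_to_fls_theta_1_2:
  "m > 0 \<Longrightarrow> fps_to_fls (ramanujan_theta (fps_X ^ m) (fps_X ^ (2 * m))) =
     Eq (2 * m) * Eq (3 * m) ^ 2 / (Eq m * Eq (6 * m))"
  using arg_cong[OF ramanujan_theta_1_2_euler[of "fps_X ^ m"], of fps_to_fls]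
  by (simp add: euler_function_to_fls mult.commute[of _ m] flip: power_mult)

lemma fps_to_fls_theta_1_5:
  "m > 0 \<Longrightarrow> fps_to_fls (ramanujan_theta (- (fps_X ^ m)) (- (fps_X ^ (5 * m)))) =
     Eq m * Eq (6 * m) ^ 2 / (Eq (2 * m) * Eq (3 * m))"
  using arg_cong[OF ramanujan_theta_1_5_euler[of "fps_X ^ m"], of fps_to_fls]
  by (simp add: euler_function_to_fls mult.commute[of _ m] flip: power_mult)

lemma fls_X_mult_theta_3_15:
  "fls_X * fps_to_fls (ramanujan_theta (- (fps_X ^ 3)) (- (fps_X ^ 15))) = phi 9 * tau"
  using fps_to_fls_theta_1_5[of 3] by (simp add: phi_def tau_def field_simps eval_nat_numeral)

lemma phi_trisection: "phi 1 = phi 9 * (1 - 2 * tau)"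
proof -
  have "phi 1 = phi 9 - 2 * (fls_X * fps_to_fls (ramanujan_theta (- (fps_X ^ 3)) (- (fps_X ^ 15))))"
    using arg_cong[OF ramanujan_theta_phi_trisection[of "fps_X :: rat fps"], of fps_to_fls]
      fps_to_fls_theta_phi[of 1] fps_to_fls_theta_phi[of 9]
    by (simp add: fls_times_fps_to_fls mult.assoc)
  thus ?thesis
    by (simp add: fls_X_mult_theta_3_15 right_diff_distrib)
qed

lemma psi_trisection: "psi 1 = fls_X * psi 9 * (1 + 1 / tau)"
proof -
  have "2 * psi 1 = 2 * (Eq 6 * Eq 9 ^ 2 / (Eq 3 * Eq 18) + fls_X * psi 9)"
    using arg_cong[OF ramanujan_theta_psi_trisection[of "fps_X :: rat fps"], of fps_to_fls]
      fps_to_fls_theta_psi[of 1] fps_to_fls_theta_psi[of 9] fps_to_fls_theta_1_2[of 3]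
    by (simp add: fls_times_fps_to_fls mult.left_commute)
  hence "psi 1 = Eq 6 * Eq 9 ^ 2 / (Eq 3 * Eq 18) + fls_X * psi 9"
    by (simp only: mult_cancel_left) simp
  also have "\<dots> = fls_X * psi 9 * (1 + 1 / tau)"
    by (simp add: psi_def tau_def field_simps eval_nat_numeral)
  finally show ?thesis .
qed

lemma trinorm_ramanujan_theta_phi:
  "trinorm (ramanujan_theta (- fps_X) (- fps_X)) = ramanujan_theta (- (fps_X ^ 9)) (- (fps_X ^ 9)) ^ 3
     - 8 * (fps_X * ramanujan_theta (- (fps_X ^ 3)) (- (fps_X ^ 15) :: rat fps)) ^ 3"
proof -
  let ?p = "ramanujan_theta (- (fps_X ^ 3)) (- (fps_X ^ 3)) :: rat fps"
  let ?w = "ramanujan_theta (- fps_X) (- (fps_X ^ 5)) :: rat fps"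
  have "?p oo fps_X ^ 3 = ramanujan_theta (- (fps_X ^ 9)) (- (fps_X ^ 9))"
    "?w oo fps_X ^ 3 = ramanujan_theta (- (fps_X ^ 3)) (- (fps_X ^ 15))"
    by (simp_all add: fps_compose_ramanujan_theta fps_compose_uminus fps_compose_power[symmetric] flip: power_mult)
  note sections = this[symmetric]
  have "trinorm (ramanujan_theta (- fps_X) (- fps_X)) =
      trinorm ((?p oo fps_X ^ 3) + fps_X * ((- 2 * ?w) oo fps_X ^ 3))"
    using ramanujan_theta_phi_trisection[of "fps_X :: rat fps"] unfolding sections
    by (simp add: fps_compose_mult_distrib fps_compose_uminus mult_ac)
  also have "\<dots> = (?p oo fps_X ^ 3) ^ 3 - 8 * (fps_X * (?w oo fps_X ^ 3)) ^ 3"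
    unfolding trinorm_add_X_mult
    by (simp add: fps_compose_mult_distrib fps_compose_uminus power_mult_distrib)
  finally show ?thesis
    unfolding sections .
qed

lemma fps_to_fls_trinorm_euler_function:
  assumes "\<not> 3 dvd m"
  shows "fps_to_fls (trinorm (euler_function (fps_X ^ m))) = Eq (3 * m) ^ 4 / Eq (9 * m)"
proof -
  have "m > 0"
    using assms by (cases m) auto
  thus ?thesis
    using arg_cong[OF trinorm_euler_function[OF assms], of fps_to_fls] by (simp add: euler_function_to_fls)
qed

lemma fps_to_fls_trinorm_theta_phi:
  "fps_to_fls (trinorm (ramanujan_theta (- fps_X) (- fps_X))) = phi 3 ^ 4 / phi 9" (is "?n = _")
proof -
  have "trinorm (ramanujan_theta (- fps_X) (- fps_X)) * trinorm (euler_function (fps_X ^ 2)) =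
      trinorm (euler_function fps_X :: rat fps) ^ 2"
    using ramanujan_theta_phi_euler[of "fps_X :: rat fps"] by (simp flip: trinorm_mult trinorm_power)
  from arg_cong[OF this, of fps_to_fls] have "?n * (Eq 6 ^ 4 / Eq 18) = (Eq 3 ^ 4 / Eq 9) ^ 2"
    using fps_to_fls_trinorm_euler_function[of 1] fps_to_fls_trinorm_euler_function[of 2]
    by (simp add: fls_times_fps_to_fls fps_to_fls_power)
  thus ?thesis
    by (simp add: phi_def field_simps)
qed

lemma phi_3_power4_conv_tau: "phi 3 ^ 4 = phi 9 ^ 4 * (1 - 8 * tau ^ 3)"
proof -
  have "phi 3 ^ 4 / phi 9 = phi 9 ^ 3 - 8 * (phi 9 * tau) ^ 3"
    unfolding fps_to_fls_trinorm_theta_phi[symmetric] trinorm_ramanujan_theta_phi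
    using fps_to_fls_theta_phi[of 9]
    by (simp add: fps_to_fls_power fls_times_fps_to_fls flip: fls_X_mult_theta_3_15)
  thus ?thesis
    by (simp add: field_simps eval_nat_numeral)
qed

definition phi_ratio :: "rat fls" where
  "phi_ratio = phi 9 / phi 1"

lemma phi_ratio_mult_tau: "(1 - 2 * tau) * phi_ratio = 1"
  using phi_trisection phi_nonzero[of 1] by (simp add: phi_ratio_def field_simps)

lemma xi_conv_tau: "xi = (1 + 1 / tau) ^ 2 * phi_ratio"
proof -
  have "fls_X_intpow (-2) = (1 / fls_X ^ 2 :: rat fls)"
    by (simp add: fls_X_power_conv_shift_1 divide_inverse fls_inverse_X_intpow)
  hence "xi = (psi 1 / (fls_X * psi 9)) ^ 2 * phi_ratio"
    by (simp add: xi_def psi_def phi_def phi_ratio_def field_simps eval_nat_numeral)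
  thus ?thesis
    unfolding psi_trisection by simp
qed

lemma Xs_conv_phi: "Xs = phi 3 ^ 4 / phi 1 ^ 4"
  by (simp add: Xs_def phi_def field_simps flip: numeral_2_eq_2)

subsection \<open>The cubic equation and the recurrence\<close>

lemma V3_Xs: "V3 Xs = phi 9 ^ 4 / phi 3 ^ 4"
  by (simp add: Xs_conv_phi fls_compose_power_divide phi_compose_power del: power_one_right)

lemma phi_ratio_power4: "phi_ratio ^ 4 = Xs * V3 Xs"
  unfolding phi_ratio_def V3_Xs by (simp add: Xs_conv_phi power_divide)

lemma phi_ratio_cubic: "phi_ratio ^ 3 = V3 Xs * (3 * phi_ratio ^ 2 - 3 * phi_ratio + 1)"
proof -
  have "V3 Xs * (1 - 8 * tau ^ 3) = 1"
    using phi_3_power4_conv_tau by (simp add: V3_Xs field_simps)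
  thus ?thesis
    using phi_ratio_mult_tau by algebra
qed

lemma U3_phi_ratio_rec:
  "U3 (f * phi_ratio ^ (n + 3)) =
     Xs * (3 * U3 (f * phi_ratio ^ (n + 2)) - 3 * U3 (f * phi_ratio ^ (n + 1)) + U3 (f * phi_ratio ^ n))"
proof -
  have "f * phi_ratio ^ (n + 3) = V3 Xs *
      (3 * (f * phi_ratio ^ (n + 2)) - 3 * (f * phi_ratio ^ (n + 1)) + f * phi_ratio ^ n)"
    by (simp add: power_add phi_ratio_cubic) (simp add: algebra_simps power2_eq_square)
  thus ?thesis
    by (simp only: U3_V3_mult U3_add U3_diff U3_numeral_mult)
qed

lemma U3_phi_ratio_power: "U3 (f * phi_ratio ^ (4 * k)) = Xs ^ k * U3 (f * Xs ^ k)"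
proof -
  have "phi_ratio ^ (4 * k) = V3 (Xs ^ k) * Xs ^ k"
    by (simp add: power_mult[of phi_ratio] phi_ratio_power4 power_mult_distrib)
  hence "f * phi_ratio ^ (4 * k) = V3 (Xs ^ k) * (f * Xs ^ k)"
    by (simp only: mult_ac)
  thus ?thesis
    by (simp only: U3_V3_mult)
qed

lemma U3_tau_power_int:
  assumes "\<not> 3 dvd k"
  shows "U3 (tau powi k) = 0"
proof -
  define w where "w = Eq 1 * Eq 6 ^ 3 / (Eq 2 * Eq 3 ^ 3)"
  have tau: "tau = fls_X * V3 w"
    by (simp add: w_def tau_def fls_compose_power_divide Eq_compose_power del: power_one_right)
  have "tau powi k = fls_X_intpow k * V3 (w powi k)"
    unfolding tau
    by (simp only: power_int_mult_distrib fls_X_power_int fls_compose_power_power_int zero_less_numeral)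
  thus ?thesis
    using U3_X_intpow_mult_V3[OF assms, of "w powi k"] by (simp only:)
qed

lemma U3_laurent_tau:
  "U3 (V3 a + V3 b * tau + V3 c * tau ^ 2 + V3 d * (1 / tau) + V3 e * (1 / tau) ^ 2) = a"
  using U3_tau_power_int[of 1] U3_tau_power_int[of 2] U3_tau_power_int[of "- 1"] U3_tau_power_int[of "- 2"]
  by (simp add: U3_add U3_V3 U3_V3_mult power_int_minus divide_inverse power_inverse)

text \<open>The factor \<open>(1 - 2\<tau>)\<^sup>2\<close> shifts the index so that the three initial values are constants.\<close>
definition xi_moment :: "nat \<Rightarrow> rat fls" where
  "xi_moment n = U3 ((1 + 1 / tau) ^ 2 * (1 - 2 * tau) ^ 2 * phi_ratio ^ n)"

lemma xi_moment_rec: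
  assumes "n \<ge> 3"
  shows "xi_moment n = Xs * (3 * xi_moment (n - 1) - 3 * xi_moment (n - 2) + xi_moment (n - 3))"
proof -
  obtain m where "n = m + 3"
    using assms by (metis le_add_diff_inverse2)
  thus ?thesis
    by (simp add: xi_moment_def U3_phi_ratio_rec)
qed

lemma xi_moment_conv_xi: "xi_moment (4 * k + 3) = Xs ^ k * U3 (xi * Xs ^ k)"
proof -
  have xi: "(1 + 1 / tau) ^ 2 * (1 - 2 * tau) ^ 2 * phi_ratio ^ 3 = xi"
    unfolding xi_conv_tau using phi_ratio_mult_tau by algebra
  have "xi_moment (4 * k + 3) =
      U3 ((1 + 1 / tau) ^ 2 * (1 - 2 * tau) ^ 2 * phi_ratio ^ 3 * phi_ratio ^ (4 * k))"
    unfolding xi_moment_def power_add by (simp only: mult_ac)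
  thus ?thesis
    by (simp only: xi U3_phi_ratio_power)
qed

lemma xi_moment_initial: "xi_moment 0 = - 3" "xi_moment 1 = - 3" "xi_moment 2 = 1"
proof -
  have "(1 + 1 / tau) ^ 2 * (1 - 2 * tau) ^ 2 =
      V3 (- 3) + V3 4 * tau + V3 4 * tau ^ 2 + V3 (- 2) * (1 / tau) + V3 1 * (1 / tau) ^ 2"
    by (simp add: V3_numeral field_simps power2_eq_square)
  thus "xi_moment 0 = - 3"
    by (simp only: xi_moment_def U3_laurent_tau power_0 mult_1_right)
  have "(1 + 1 / tau) ^ 2 * (1 - 2 * tau) ^ 2 * phi_ratio ^ 1 = (1 + 1 / tau) ^ 2 * (1 - 2 * tau)"
    using phi_ratio_mult_tau by algebra
  also have "\<dots> = V3 (- 3) + V3 (- 2) * tau + V3 0 * tau ^ 2 + V3 0 * (1 / tau) + V3 1 * (1 / tau) ^ 2"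
    by (simp add: V3_numeral field_simps power2_eq_square)
  finally show "xi_moment 1 = - 3"
    by (simp only: xi_moment_def U3_laurent_tau)
  have "(1 + 1 / tau) ^ 2 * (1 - 2 * tau) ^ 2 * phi_ratio ^ 2 = (1 + 1 / tau) ^ 2"
    using phi_ratio_mult_tau by algebra
  also have "\<dots> = V3 1 + V3 0 * tau + V3 0 * tau ^ 2 + V3 2 * (1 / tau) + V3 1 * (1 / tau) ^ 2"
    by (simp add: V3_numeral field_simps power2_eq_square)
  finally show "xi_moment 2 = 1"
    by (simp only: xi_moment_def U3_laurent_tau)
qed

lemma xi_moment_3: "xi_moment 3 = 9 * Xs"
  unfolding xi_moment_rec[of 3, simplified] xi_moment_initial[simplified] by algebra

lemma xi_moment_4: "xi_moment 4 = - 6 * Xs + 27 * Xs ^ 2"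
  unfolding xi_moment_rec[of 4, simplified] xi_moment_initial[simplified] xi_moment_3 by algebra

lemma xi_moment_5: "xi_moment 5 = Xs - 45 * Xs ^ 2 + 81 * Xs ^ 3"
  unfolding xi_moment_rec[of 5, simplified] xi_moment_initial[simplified] xi_moment_3 xi_moment_4 by algebra

lemma xi_moment_6: "xi_moment 6 = 30 * Xs ^ 2 - 216 * Xs ^ 3 + 243 * Xs ^ 4"
  unfolding xi_moment_rec[of 6, simplified] xi_moment_3 xi_moment_4 xi_moment_5 by algebra

lemma xi_moment_7: "xi_moment 7 = Xs * (- 9 * Xs + 252 * Xs ^ 2 - 891 * Xs ^ 3 + 729 * Xs ^ 4)"
  unfolding xi_moment_rec[of 7, simplified] xi_moment_4 xi_moment_5 xi_moment_6 by algebra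

lemma xi_moment_8: "xi_moment 8 = Xs ^ 2 - 162 * Xs ^ 3 + 1485 * Xs ^ 4 - 3402 * Xs ^ 5 + 2187 * Xs ^ 6"
  unfolding xi_moment_rec[of 8, simplified] xi_moment_5 xi_moment_6 xi_moment_7 by algebra

lemma xi_moment_9:
  "xi_moment 9 = 60 * Xs ^ 3 - 1458 * Xs ^ 4 + 7371 * Xs ^ 5 - 12393 * Xs ^ 6 + 6561 * Xs ^ 7"
  unfolding xi_moment_rec[of 9, simplified] xi_moment_6 xi_moment_7 xi_moment_8 by algebra

lemma xi_moment_10:
  "xi_moment 10 = - 12 * Xs ^ 3 + 918 * Xs ^ 4 - 9720 * Xs ^ 5 + 33048 * Xs ^ 6 - 43740 * Xs ^ 7
    + 19683 * Xs ^ 8"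
  unfolding xi_moment_rec[of 10, simplified] xi_moment_7 xi_moment_8 xi_moment_9 by algebra

lemma xi_moment_11:
  "xi_moment 11 = Xs ^ 2 * (Xs - 378 * Xs ^ 2 + 8613 * Xs ^ 3 - 54675 * Xs ^ 4 + 138510 * Xs ^ 5
    - 150903 * Xs ^ 6 + 59049 * Xs ^ 7)"
  unfolding xi_moment_rec[of 11, simplified] xi_moment_8 xi_moment_9 xi_moment_10 by algebra

lemma xi_moment_12:
  "xi_moment 12 = 99 * Xs ^ 4 - 5346 * Xs ^ 5 + 62370 * Xs ^ 6 - 275562 * Xs ^ 7 + 553311 * Xs ^ 8
    - 511758 * Xs ^ 9 + 177147 * Xs ^ 10"
  unfolding xi_moment_rec[of 12, simplified] xi_moment_9 xi_moment_10 xi_moment_11 by algebra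

lemma xi_moment_13:
  "xi_moment 13 = - 15 * Xs ^ 4 + 2349 * Xs ^ 5 - 51597 * Xs ^ 6 + 384183 * Xs ^ 7
    - 1285956 * Xs ^ 8 + 2132325 * Xs ^ 9 - 1712421 * Xs ^ 10 + 531441 * Xs ^ 11"
  unfolding xi_moment_rec[of 13, simplified] xi_moment_10 xi_moment_11 xi_moment_12 by algebra

lemma xi_moment_14:
  "xi_moment 14 = Xs ^ 4 - 720 * Xs ^ 5 + 31698 * Xs ^ 6 - 396576 * Xs ^ 7 + 2117745 * Xs ^ 8
    - 5668704 * Xs ^ 9 + 7991298 * Xs ^ 10 - 5668704 * Xs ^ 11 + 1594323 * Xs ^ 12"
  unfolding xi_moment_rec[of 14, simplified] xi_moment_11 xi_moment_12 xi_moment_13 by algebra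

lemma xi_moment_15:
  "xi_moment 15 = Xs ^ 3 * (147 * Xs ^ 2 - 14553 * Xs ^ 3 + 312255 * Xs ^ 4 - 2617839 * Xs ^ 5
    + 10764414 * Xs ^ 6 - 23914845 * Xs ^ 7 + 29288304 * Xs ^ 8 - 18600435 * Xs ^ 9
    + 4782969 * Xs ^ 10)"
  unfolding xi_moment_rec[of 15, simplified] xi_moment_12 xi_moment_13 xi_moment_14 by algebra

theorem theorem2p4:
  shows "U3 xi = 9 * Xs \<and>
    U3 (xi * Xs) = - 9 * Xs + 252 * Xs ^ 2 - 891 * Xs ^ 3 + 729 * Xs ^ 4 \<and>
    U3 (xi * Xs ^ 2) = Xs - 378 * Xs ^ 2 + 8613 * Xs ^ 3 - 54675 * Xs ^ 4
           + 138510 * Xs ^ 5 - 150903 * Xs ^ 6 + 59049 * Xs ^ 7 \<and>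
    U3 (xi * Xs ^ 3) = 147 * Xs ^ 2 - 14553 * Xs ^ 3 + 312255 * Xs ^ 4
           - 2617839 * Xs ^ 5 + 10764414 * Xs ^ 6 - 23914845 * Xs ^ 7
           + 29288304 * Xs ^ 8 - 18600435 * Xs ^ 9 + 4782969 * Xs ^ 10"
proof -
  have "Xs \<noteq> 0"
    by (simp add: Xs_conv_phi)
  thus ?thesis
    using xi_moment_conv_xi[of 0] xi_moment_conv_xi[of 1] xi_moment_conv_xi[of 2] xi_moment_conv_xi[of 3]
      xi_moment_3 xi_moment_7 xi_moment_11 xi_moment_15
    by simp
qed

end
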